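(* Let $\{(x^k,y^k,s^k,\mu^k)\}\subset\mathbb{R}^n\times\mathbb{R}^m\times\mathbb{R}^m\times\mathbb{R}$ with $\mu^k>0$ and $\mu^k\to 0$ be such that: 1. $x^k\to x^*$ with $a(x^* )\le 0$, and $s^k\to s^*:=-a(x^* )$; 2. $y^k\ge 0$ and $s^k\ge 0$ with $y^k\to y^*$ ($y^*$ is necessarily a Lagrange multiplier associated with $x^*$); 3. for some $0<b\le c$ (independent of $k$), $\mu^k b\le y_i^k s_i^k$ for all $i$ with $a_i(x^* )=0$, and $(y^k)^{T}s^k\le\mu^k c$; 4. for some $u\ge 0$ (independent of $k$), $|a_i(x^k)+s_i^k|\le\mu^k u$ for all $i$ with $a_i(x^* )=0$; 5. for some $d\ge 0$ (independent of $k$), $\|\nabla_x\mathcal{L}(x^k,y^k)\|\le d\mu^k(\|y^k\|_1+1)$; 6. $f$ and $a$ are twice continuously differentiable and $(x^*,y^* )$ satisfies the sufficient second-order optimality condition: for some $\lambda>0$, $v^{T}\nabla^2_{xx}\mathcal{L}(x^*,y^* )v\ge\lambda\|v\|^2$ for all $v\in\mathbb{R}^n$ such that $\nabla f(x^* )^{T}v\le 0$ and $\nabla a_i(x^* )^{T}v\le 0$ for all $i$ with $a_i(x^* )=0$. Then $y^*$ is maximally complementary, i.e., $y_i^*>0$ whenever there exists some Lagrange multiplier $\tilde y$ associated with $x^*$ with $\tilde y_i>0$.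
   Context: The functions are $f:\mathbb{R}^n\to\mathbb{R}$ and $a=(a_1,\dots,a_m):\mathbb{R}^n\to\mathbb{R}^m$. The problem under consideration is: minimize $f(x)$ subject to $a(x)+s=0$, $s\ge 0$ (equivalently, minimize $f(x)$ subject to $a(x)\le 0$). Vector inequalities are componentwise. The Lagrangian is $\mathcal{L}(x,y):=f(x)+y^{T}a(x)$. A Lagrange multiplier associated with a feasible point $x^*$ is a vector $y^*\in\mathbb{R}^m$ with $\nabla_x\mathcal{L}(x^*,y^* )=0$, $y^*\ge 0$ and $a(x^* )^{T}y^*=0$. $\|\cdot\|$ is the Euclidean norm, $\|\cdot\|_1$ the $\ell_1$-norm. Conditions on sequence elements stated without an explicit quantifier over $k$ are meant for all sufficiently large $k$. *)

theory Defs
  imports "HOL-Analysis.Analysis"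
begin

definition gradient :: "(real^'n \<Rightarrow> real) \<Rightarrow> real^'n \<Rightarrow> real^'n" where
  "gradient f x = (\<chi> i. frechet_derivative f (at x) (axis i 1))"

lemma gradient_works:
  assumes "f differentiable (at x)"
  shows "GDERIV f x :> gradient f x"
proof -
  let ?D = "frechet_derivative f (at x)"
  have D: "(f has_derivative ?D) (at x)"
    using assms by (simp add: frechet_derivative_works)
  have "?D h = inner h (gradient f x)" for h
  proof -
    have "?D h = ?D (\<Sum>i\<in>UNIV. h $ i *\<^sub>R axis i 1)"
      using basis_expansion[of h] by (simp add: scalar_mult_eq_scaleR)
    also have "\<dots> = (\<Sum>i\<in>UNIV. h $ i *\<^sub>R ?D (axis i 1))"
      using has_derivative_linear[OF D] by (simp add: linear_sum linear_cmul)
    finally show ?thesis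
      by (simp add: gradient_def inner_vec_def)
  qed
  then show ?thesis
    using D unfolding gderiv_def by (metis ext)
qed

definition hessian :: "(real^'n \<Rightarrow> real) \<Rightarrow> real^'n \<Rightarrow> real^'n^'n" where
  "hessian f x = jacobian (gradient f) (at x)"

text \<open>The values of \<^term>\<open>gradient\<close> and \<^term>\<open>hessian\<close> are meaningful only at points of
  differentiability, so differentiability is required explicitly here.\<close>

definition twice_continuously_differentiable :: "(real^'n \<Rightarrow> real) \<Rightarrow> bool" where
  "twice_continuously_differentiable f \<longleftrightarrow>
     (\<forall>x. f differentiable (at x)) \<and>
     (\<forall>x. gradient f differentiable (at x)) \<and>
     continuous_on UNIV (hessian f)"

definition l1_norm :: "real^'m \<Rightarrow> real" where
  "l1_norm y = (\<Sum>i\<in>UNIV. \<bar>y $ i\<bar>)"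

definition lagrangian ::
  "(real^'n \<Rightarrow> real) \<Rightarrow> (real^'n \<Rightarrow> real^'m) \<Rightarrow> real^'n \<Rightarrow> real^'m \<Rightarrow> real" where
  "lagrangian f a x y = f x + y \<bullet> a x"

definition grad_lagrangian ::
  "(real^'n \<Rightarrow> real) \<Rightarrow> (real^'n \<Rightarrow> real^'m) \<Rightarrow> real^'n \<Rightarrow> real^'m \<Rightarrow> real^'n" where
  "grad_lagrangian f a x y = gradient (\<lambda>z. lagrangian f a z y) x"

definition hessian_lagrangian ::
  "(real^'n \<Rightarrow> real) \<Rightarrow> (real^'n \<Rightarrow> real^'m) \<Rightarrow> real^'n \<Rightarrow> real^'m \<Rightarrow> real^'n^'n" where
  "hessian_lagrangian f a x y = hessian (\<lambda>z. lagrangian f a z y) x"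

text \<open>The order on \<^typ>\<open>real^'m\<close> is componentwise.\<close>

definition lagrange_multiplier ::
  "(real^'n \<Rightarrow> real) \<Rightarrow> (real^'n \<Rightarrow> real^'m) \<Rightarrow> real^'n \<Rightarrow> real^'m \<Rightarrow> bool" where
  "lagrange_multiplier f a x y \<longleftrightarrow>
     grad_lagrangian f a x y = 0 \<and> 0 \<le> y \<and> a x \<bullet> y = 0"

definition active :: "(real^'n \<Rightarrow> real^'m) \<Rightarrow> real^'n \<Rightarrow> 'm set" where
  "active a x = {i. a x $ i = 0}"

definition second_order_sufficient ::
  "(real^'n \<Rightarrow> real) \<Rightarrow> (real^'n \<Rightarrow> real^'m) \<Rightarrow> real^'n \<Rightarrow> real^'m \<Rightarrow> bool" where
  "second_order_sufficient f a x y \<longleftrightarrow>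
     (\<exists>lam>0. \<forall>v.
        gradient f x \<bullet> v \<le> 0 \<and> (\<forall>i\<in>active a x. gradient (\<lambda>z. a z $ i) x \<bullet> v \<le> 0) \<longrightarrow>
        v \<bullet> (hessian_lagrangian f a x y *v v) \<ge> lam * (norm v)\<^sup>2)"

definition maximally_complementary ::
  "(real^'n \<Rightarrow> real) \<Rightarrow> (real^'n \<Rightarrow> real^'m) \<Rightarrow> real^'n \<Rightarrow> real^'m \<Rightarrow> bool" where
  "maximally_complementary f a x y \<longleftrightarrow>
     (\<forall>i. (\<exists>y'. lagrange_multiplier f a x y' \<and> y' $ i > 0) \<longrightarrow> y $ i > 0)"

end

theory Submission
  imports Defs
begin

text \<open>Write \<open>h = x\<^sup>k - x\<^sup>*\<close>, and replace a given multiplier by a point \<open>y'\<close> on the segment from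
  \<open>y\<^sup>*\<close> towards it, close to \<open>y\<^sup>*\<close>. Then \<open>(y' - y\<^sup>k) \<bullet> a(x\<^sup>k)\<close> is bounded below by the Hessian form
  of the Lagrangian at \<open>h\<close>, minus a small multiple of \<open>|h|\<^sup>2\<close> and \<open>O(\<mu>\<^sup>k)\<close>. If \<open>|h|\<^sup>2 \<le> \<mu>\<^sup>k\<close>, this is
  trivially at least \<open>-O(\<mu>\<^sup>k)\<close>; otherwise the direction of \<open>h\<close> is close to the critical cone, where
  the second-order condition makes the form absorb the error. Since \<open>a(x\<^sup>k)\<close> is \<open>-s\<^sup>k\<close> up to \<open>O(\<mu>\<^sup>k)\<close>
  on the active constraints, \<open>y' \<bullet> s\<^sup>k = O(\<mu>\<^sup>k)\<close>, so \<open>s\<^sup>k\<^sub>i = O(\<mu>\<^sup>k)\<close> wherever \<open>y'\<^sub>i > 0\<close>, and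
  \<open>\<mu>\<^sup>k b \<le> y\<^sup>k\<^sub>i s\<^sup>k\<^sub>i\<close> keeps \<open>y\<^sup>k\<^sub>i\<close> away from zero.\<close>

section \<open>First derivative of the Lagrangian\<close>

lemma grad_lagrangian_eq:
  fixes f :: "real^'n \<Rightarrow> real" and a :: "real^'n \<Rightarrow> real^'m"
  assumes f: "f differentiable (at x)"
    and a: "\<And>i. (\<lambda>z. a z $ i) differentiable (at x)"
  shows "(\<lambda>z. lagrangian f a z y) differentiable (at x)"
    and "grad_lagrangian f a x y =
      gradient f x + (\<Sum>i\<in>UNIV. y $ i *\<^sub>R gradient (\<lambda>z. a z $ i) x)"
proof -
  let ?G = "gradient f x + (\<Sum>i\<in>UNIV. y $ i *\<^sub>R gradient (\<lambda>z. a z $ i) x)"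
  let ?L = "\<lambda>z. lagrangian f a z y"
  have fD: "(f has_derivative (\<lambda>h. h \<bullet> gradient f x)) (at x)"
    using gradient_works[OF f] by (simp add: gderiv_def)
  have aD: "((\<lambda>z. a z $ i) has_derivative (\<lambda>h. h \<bullet> gradient (\<lambda>z. a z $ i) x)) (at x)" for i
    using gradient_works[OF a] by (simp add: gderiv_def)
  have "(?L has_derivative (\<lambda>h. h \<bullet> gradient f x +
      (\<Sum>i\<in>UNIV. y $ i * (h \<bullet> gradient (\<lambda>z. a z $ i) x)))) (at x)"
    unfolding lagrangian_def inner_vec_def inner_real_def
    by (intro has_derivative_add has_derivative_sum has_derivative_mult_right
        fD[unfolded inner_vec_def inner_real_def] aD[unfolded inner_vec_def inner_real_def])
  then have D: "(?L has_derivative (\<lambda>h. h \<bullet> ?G)) (at x)"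
    by (simp add: inner_add_right inner_sum_right)
  then show dL: "?L differentiable (at x)"
    using differentiable_def by blast
  show "grad_lagrangian f a x y = ?G"
  proof -
    have "(?L has_derivative (\<lambda>h. h \<bullet> gradient ?L x)) (at x)"
      using gradient_works[OF dL] by (simp add: gderiv_def)
    from has_derivative_unique[OF this D] have "\<forall>h. h \<bullet> gradient ?L x = h \<bullet> ?G"
      by (rule fun_cong[THEN allI])
    then show ?thesis
      unfolding grad_lagrangian_def vector_eq_ldot .
  qed
qed

section \<open>Quadratic remainder estimates from differentiability of the gradient\<close>

text \<open>Differentiability of the gradient at \<open>x0\<close> bounds its increments from
  \<open>x0\<close> alone: \<open>K\<close> bounds the derivative and the extra 1 absorbs the
  remainder.\<close>

lemma gradient_lipschitz_at:
  fixes g :: "real^'n \<Rightarrow> real"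
  assumes "gradient g differentiable (at x0)"
  obtains C where "C \<ge> 0"
    "\<forall>\<^sub>F x in nhds x0. norm (gradient g x - gradient g x0) \<le> C * norm (x - x0)"
proof -
  obtain D where D: "(gradient g has_derivative D) (at x0)"
    using assms differentiable_def by blast
  have bl: "bounded_linear D"
    using D has_derivative_bounded_linear by blast
  obtain K where K: "K \<ge> 0" "\<And>h. norm (D h) \<le> norm h * K"
    using bounded_linear.nonneg_bounded[OF bl] by blast
  obtain r where r: "r > 0"
    "\<And>y. norm (y - x0) < r \<Longrightarrow> norm (gradient g y - gradient g x0 - D (y - x0)) \<le> 1 * norm (y - x0)"
    using D unfolding has_derivative_at_alt by (meson zero_less_one)
  have "norm (gradient g y - gradient g x0) \<le> (K + 1) * norm (y - x0)" if "dist y x0 < r" for y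
  proof -
    have "norm (gradient g y - gradient g x0) \<le>
        norm (gradient g y - gradient g x0 - D (y - x0)) + norm (D (y - x0))"
      by (metis diff_add_cancel norm_triangle_ineq)
    then show ?thesis
      using r(2)[of y] K(2)[of "y - x0"] that by (simp add: dist_norm algebra_simps)
  qed
  then have "\<forall>\<^sub>F y in nhds x0. norm (gradient g y - gradient g x0) \<le> (K + 1) * norm (y - x0)"
    unfolding eventually_nhds_metric using r(1) by blast
  with K(1) show thesis
    by (intro that[of "K + 1"]) auto
qed

text \<open>By the mean value theorem the increment of \<open>g\<close> is the gradient at an
  intermediate point applied to \<open>x - x0\<close>. Moving that gradient to either endpoint costs
  a multiple of |x - x0|, hence a quadratic error.\<close>

lemma gradient_error_quadratic:
  fixes g :: "real^'n \<Rightarrow> real"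
  assumes dg: "\<And>x. g differentiable (at x)" and "gradient g differentiable (at x0)"
  obtains C where "C \<ge> 0"
    "\<forall>\<^sub>F x in nhds x0. \<bar>g x - g x0 - gradient g x0 \<bullet> (x - x0)\<bar> \<le> C * (norm (x - x0))\<^sup>2
      \<and> \<bar>g x - g x0 - gradient g x \<bullet> (x - x0)\<bar> \<le> C * (norm (x - x0))\<^sup>2"
proof -
  obtain C where C: "C \<ge> 0"
    "\<forall>\<^sub>F x in nhds x0. norm (gradient g x - gradient g x0) \<le> C * norm (x - x0)"
    using gradient_lipschitz_at[OF assms(2)] by blast
  obtain r where r: "r > 0"
    "\<And>x. dist x x0 < r \<Longrightarrow> norm (gradient g x - gradient g x0) \<le> C * norm (x - x0)"
    using C(2) unfolding eventually_nhds_metric by blast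
  have "\<bar>g x - g x0 - gradient g x0 \<bullet> (x - x0)\<bar> \<le> 2 * C * (norm (x - x0))\<^sup>2
      \<and> \<bar>g x - g x0 - gradient g x \<bullet> (x - x0)\<bar> \<le> 2 * C * (norm (x - x0))\<^sup>2"
    if x: "dist x x0 < r" for x
  proof -
    define h where "h = x - x0"
    have D: "((\<lambda>t. g (x0 + t *\<^sub>R h)) has_derivative (\<lambda>s. s * (h \<bullet> gradient g (x0 + t *\<^sub>R h)))) (at t)" for t
    proof -
      have "((\<lambda>t. x0 + t *\<^sub>R h) has_derivative (\<lambda>s. s *\<^sub>R h)) (at t)"
        by (auto intro!: derivative_eq_intros)
      moreover have "(g has_derivative (\<lambda>v. v \<bullet> gradient g (x0 + t *\<^sub>R h))) (at (x0 + t *\<^sub>R h))"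
        using gradient_works[OF dg] by (simp add: gderiv_def)
      ultimately have "((\<lambda>t. g (x0 + t *\<^sub>R h)) has_derivative
          (\<lambda>s. (s *\<^sub>R h) \<bullet> gradient g (x0 + t *\<^sub>R h))) (at t)"
        by (rule has_derivative_compose)
      then show ?thesis
        by simp
    qed
    obtain t where t: "0 < t" "t < 1"
      "g (x0 + 1 *\<^sub>R h) - g (x0 + 0 *\<^sub>R h) = (1 - 0) * (h \<bullet> gradient g (x0 + t *\<^sub>R h))"
      using mvt_simple[of 0 1 "\<lambda>t. g (x0 + t *\<^sub>R h)"
          "\<lambda>t s. s * (h \<bullet> gradient g (x0 + t *\<^sub>R h))"] has_derivative_at_withinI[OF D]
      by auto
    have g: "g x - g x0 = h \<bullet> gradient g (x0 + t *\<^sub>R h)"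
      using t by (simp add: h_def)
    have "t * norm h \<le> norm h"
      using t by (simp add: mult_left_le_one_le)
    moreover have "dist (x0 + t *\<^sub>R h) x0 = t * norm h"
      using t by (simp add: dist_norm)
    ultimately have n1: "norm (gradient g (x0 + t *\<^sub>R h) - gradient g x0) \<le> C * norm h"
      using r(2)[of "x0 + t *\<^sub>R h"] x C(1) mult_left_mono[of "t * norm h" "norm h" C] t
      by (simp add: h_def dist_norm)
    have n2: "norm (gradient g x - gradient g x0) \<le> C * norm h"
      using r(2)[OF x] by (simp add: h_def)
    \<comment> \<open>The Lipschitz bound is anchored at \<open>x0\<close>, so the two gradients are
      compared through \<open>x0\<close>; this doubles the constant.\<close>
    have n3: "norm (gradient g (x0 + t *\<^sub>R h) - gradient g x) \<le> 2 * C * norm h"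
      using n1 n2 norm_triangle_ineq4[of "gradient g (x0 + t *\<^sub>R h) - gradient g x0"
          "gradient g x - gradient g x0"] by simp
    have cs: "\<bar>h \<bullet> v\<bar> \<le> 2 * C * (norm h)\<^sup>2" if "norm v \<le> 2 * C * norm h" for v
      using Cauchy_Schwarz_ineq2[of h v] mult_left_mono[OF that, of "norm h"]
      by (simp add: power2_eq_square algebra_simps)
    have "norm (gradient g (x0 + t *\<^sub>R h) - gradient g x0) \<le> 2 * C * norm h"
      using n1 mult_nonneg_nonneg[OF C(1) norm_ge_zero[of h]] by linarith
    from cs[OF this] cs[OF n3] show ?thesis
      unfolding g h_def[symmetric] by (simp add: inner_diff_right inner_commute)
  qed
  then have "\<forall>\<^sub>F x in nhds x0. \<bar>g x - g x0 - gradient g x0 \<bullet> (x - x0)\<bar> \<le> 2 * C * (norm (x - x0))\<^sup>2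
      \<and> \<bar>g x - g x0 - gradient g x \<bullet> (x - x0)\<bar> \<le> 2 * C * (norm (x - x0))\<^sup>2"
    unfolding eventually_nhds_metric using r(1) by blast
  then show thesis
    using C(1) by (intro that[of "2 * C"]) auto
qed

lemma gradient_error_quadratic_vec:
  fixes a :: "real^'n \<Rightarrow> real^'m"
  assumes "\<And>i x. (\<lambda>z. a z $ i) differentiable (at x)"
    and "\<And>i. gradient (\<lambda>z. a z $ i) differentiable (at x0)"
  obtains C where "C \<ge> 0"
    "\<forall>\<^sub>F x in nhds x0. \<forall>i.
        \<bar>a x $ i - a x0 $ i - gradient (\<lambda>z. a z $ i) x0 \<bullet> (x - x0)\<bar> \<le> C * (norm (x - x0))\<^sup>2
      \<and> \<bar>a x $ i - a x0 $ i - gradient (\<lambda>z. a z $ i) x \<bullet> (x - x0)\<bar> \<le> C * (norm (x - x0))\<^sup>2"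
proof -
  define P where "P i C x \<longleftrightarrow>
        \<bar>a x $ i - a x0 $ i - gradient (\<lambda>z. a z $ i) x0 \<bullet> (x - x0)\<bar> \<le> C * (norm (x - x0))\<^sup>2
      \<and> \<bar>a x $ i - a x0 $ i - gradient (\<lambda>z. a z $ i) x \<bullet> (x - x0)\<bar> \<le> C * (norm (x - x0))\<^sup>2"
    for i C x
  have "\<exists>C\<ge>0. \<forall>\<^sub>F x in nhds x0. P i C x" for i
  proof -
    obtain C where "C \<ge> 0" "\<forall>\<^sub>F x in nhds x0. P i C x"
      using gradient_error_quadratic[OF assms(1)[of i] assms(2)[of i]] unfolding P_def by blast
    then show ?thesis
      by blast
  qed
  then obtain C where C: "\<And>i. C i \<ge> 0" "\<And>i. \<forall>\<^sub>F x in nhds x0. P i (C i) x"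
    by metis
  \<comment> \<open>The sum of the nonnegative constants serves as one constant for all
    components.\<close>
  have "P i (\<Sum>j\<in>UNIV. C j) x" if "P i (C i) x" for i x
  proof -
    have "C i \<le> (\<Sum>j\<in>UNIV. C j)"
      using C(1) by (intro member_le_sum) auto
    then have "C i * (norm (x - x0))\<^sup>2 \<le> (\<Sum>j\<in>UNIV. C j) * (norm (x - x0))\<^sup>2"
      by (intro mult_right_mono) auto
    with that show ?thesis
      unfolding P_def by linarith
  qed
  then have "\<forall>\<^sub>F x in nhds x0. P i (\<Sum>j\<in>UNIV. C j) x" for i
    using C(2)[of i] by (auto elim: eventually_mono)
  then have "\<forall>\<^sub>F x in nhds x0. \<forall>i. P i (\<Sum>j\<in>UNIV. C j) x"
    by (simp add: eventually_all_finite)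
  then show thesis
    using that[of "\<Sum>j\<in>UNIV. C j"] C(1) unfolding P_def by (simp add: sum_nonneg)
qed

lemma hessian_works:
  fixes g :: "real^'n \<Rightarrow> real"
  assumes "gradient g differentiable (at x0)"
  shows "(gradient g has_derivative (*v) (hessian g x0)) (at x0)"
  using assms jacobian_works unfolding hessian_def by blast

text \<open>The first-order expansion of the gradient at \<open>x0\<close>, paired with the
  increment itself: the o(|x - x0|) remainder becomes o(|x - x0|^2) by Cauchy-Schwarz.\<close>

lemma gradient_expansion_along_increment:
  fixes g :: "real^'n \<Rightarrow> real"
  assumes "gradient g differentiable (at x0)" and "e > 0"
  shows "\<forall>\<^sub>F x in nhds x0. \<bar>gradient g x \<bullet> (x - x0) - gradient g x0 \<bullet> (x - x0)
      - (x - x0) \<bullet> (hessian g x0 *v (x - x0))\<bar> \<le> e * (norm (x - x0))\<^sup>2"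
proof -
  obtain r where r: "r > 0" "\<And>y. norm (y - x0) < r \<Longrightarrow>
      norm (gradient g y - gradient g x0 - hessian g x0 *v (y - x0)) \<le> e * norm (y - x0)"
    using hessian_works[OF assms(1)] assms(2) unfolding has_derivative_at_alt by meson
  have "\<bar>gradient g x \<bullet> (x - x0) - gradient g x0 \<bullet> (x - x0)
      - (x - x0) \<bullet> (hessian g x0 *v (x - x0))\<bar> \<le> e * (norm (x - x0))\<^sup>2" if "dist x x0 < r" for x
  proof -
    have "\<bar>(x - x0) \<bullet> (gradient g x - gradient g x0 - hessian g x0 *v (x - x0))\<bar>
        \<le> norm (x - x0) * (e * norm (x - x0))"
      using r(2)[of x] that
      by (intro order_trans[OF Cauchy_Schwarz_ineq2] mult_left_mono) (auto simp: dist_norm)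
    then show ?thesis
      by (simp add: inner_diff_right inner_commute power2_eq_square algebra_simps)
  qed
  then show ?thesis
    unfolding eventually_nhds_metric using r(1) by blast
qed

section \<open>Positivity of a quadratic form near a cone\<close>

text \<open>Compactness of the unit sphere: unit vectors violating the bound for tolerances tending
  to 0 would accumulate at a unit vector of the cone itself, contradicting
  \<open>cone\<close>.\<close>

lemma second_order_near_cone:
  fixes H :: "real^'n^'n" and J :: "(real^'n) set"
  assumes lam: "lam > 0"
    and cone: "\<And>v. (\<forall>p\<in>J. p \<bullet> v \<le> 0) \<Longrightarrow> v \<bullet> (H *v v) \<ge> lam * (norm v)\<^sup>2"
  obtains \<delta> where "\<delta> > 0"
    "\<And>v. (\<forall>p\<in>J. p \<bullet> v \<le> \<delta> * norm v) \<Longrightarrow> v \<bullet> (H *v v) \<ge> lam / 2 * (norm v)\<^sup>2"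
proof -
  have "\<exists>\<delta>>0. \<forall>v. norm v = 1 \<longrightarrow> (\<forall>p\<in>J. p \<bullet> v \<le> \<delta>) \<longrightarrow> v \<bullet> (H *v v) \<ge> lam / 2"
  proof (rule ccontr)
    assume "\<not> ?thesis"
    then have "\<exists>v. norm v = 1 \<and> (\<forall>p\<in>J. p \<bullet> v \<le> inverse (real (Suc n))) \<and> v \<bullet> (H *v v) < lam / 2" for n
      by (metis inverse_positive_iff_positive not_le of_nat_0_less_iff zero_less_Suc)
    then obtain v where v: "\<And>n. norm (v n) = 1"
      "\<And>n p. p \<in> J \<Longrightarrow> p \<bullet> v n \<le> inverse (real (Suc n))"
      "\<And>n. v n \<bullet> (H *v v n) < lam / 2"
      by metis
    have "v n \<in> sphere 0 1" for n
      using v(1) by simp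
    then obtain l r where l: "l \<in> sphere 0 1" "strict_mono r" "(v \<circ> r) \<longlonglongrightarrow> l"
      using compact_sphere[of "0 :: real^'n" 1] unfolding compact_def by metis
    have lim: "(\<lambda>n. v (r n)) \<longlonglongrightarrow> l"
      using l(3) by (simp add: o_def)
    have "p \<bullet> l \<le> 0" if "p \<in> J" for p
    proof (rule LIMSEQ_le)
      show "(\<lambda>n. p \<bullet> v (r n)) \<longlonglongrightarrow> p \<bullet> l"
        by (intro tendsto_intros lim)
      show "(\<lambda>n. inverse (real (Suc (r n)))) \<longlonglongrightarrow> 0"
        using LIMSEQ_subseq_LIMSEQ[OF LIMSEQ_inverse_real_of_nat l(2)] by (simp add: o_def)
      show "\<exists>N. \<forall>n\<ge>N. p \<bullet> v (r n) \<le> inverse (real (Suc (r n)))"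
        using v(2)[OF that] by blast
    qed
    then have "lam \<le> l \<bullet> (H *v l)"
      using cone[of l] l(1) by simp
    moreover have "(\<lambda>n. v (r n) \<bullet> (H *v v (r n))) \<longlonglongrightarrow> l \<bullet> (H *v l)"
      by (intro tendsto_inner lim isCont_tendsto_compose[OF _ lim]
          linear_continuous_at matrix_vector_mul_bounded_linear)
    \<comment> \<open>Strictness is lost in the limit, but \<open>lam / 2\<close> is still below
      \<open>lam\<close>; this is why half of the curvature is given up.\<close>
    then have "l \<bullet> (H *v l) \<le> lam / 2"
      by (rule LIMSEQ_le_const2) (use v(3) less_imp_le in blast)
    ultimately show False
      using lam by simp
  qed
  then obtain \<delta> where \<delta>: "\<delta> > 0"
    "\<And>v. norm v = 1 \<Longrightarrow> (\<forall>p\<in>J. p \<bullet> v \<le> \<delta>) \<Longrightarrow> v \<bullet> (H *v v) \<ge> lam / 2"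
    by blast
  \<comment> \<open>Both sides of the implication are homogeneous, so the unit vector case
    suffices.\<close>
  have "v \<bullet> (H *v v) \<ge> lam / 2 * (norm v)\<^sup>2" if "\<forall>p\<in>J. p \<bullet> v \<le> \<delta> * norm v" for v
  proof (cases "v = 0")
    case False
    let ?n = "norm v"
    let ?w = "(1 / ?n) *\<^sub>R v"
    have n: "?n > 0"
      using False by simp
    have "p \<bullet> ?w \<le> \<delta>" if "p \<in> J" for p
      using \<open>\<forall>p\<in>J. p \<bullet> v \<le> \<delta> * norm v\<close> that n by (simp add: field_simps)
    then have "lam / 2 \<le> ?w \<bullet> (H *v ?w)"
      using \<delta>(2)[of ?w] n by simp
    also have "\<dots> = (v \<bullet> (H *v v)) / ?n\<^sup>2"
      by (simp add: matrix_vector_mult_scaleR power2_eq_square)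
    finally show ?thesis
      using n by (simp only: pos_le_divide_eq zero_less_power)
  qed simp
  with \<delta>(1) show thesis
    using that by blast
qed


section \<open>Multipliers and complementarity\<close>

text \<open>The perturbed optimality conditions have right-hand sides of order \<mu>, so the exact
  ones follow by continuity of the gradients.\<close>

lemma lagrange_multiplier_limit:
  fixes f :: "real^'n \<Rightarrow> real" and a :: "real^'n \<Rightarrow> real^'m"
  assumes mu_lim: "\<mu> \<longlonglongrightarrow> 0"
    and x_lim: "x \<longlonglongrightarrow> xstar"
    and feasible: "a xstar \<le> 0"
    and s_lim: "s \<longlonglongrightarrow> - a xstar"
    and y_nonneg: "\<forall>\<^sub>F k in sequentially. 0 \<le> y k"
    and y_lim: "y \<longlonglongrightarrow> ystar"
    and compl_upper: "\<forall>\<^sub>F k in sequentially. y k \<bullet> s k \<le> \<mu> k * c"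
    and dual:
      "\<forall>\<^sub>F k in sequentially.
         norm (grad_lagrangian f a (x k) (y k)) \<le> d * \<mu> k * (l1_norm (y k) + 1)"
    and f_C2: "twice_continuously_differentiable f"
    and a_C2: "\<forall>i. twice_continuously_differentiable (\<lambda>z. a z $ i)"
  shows "lagrange_multiplier f a xstar ystar"
proof -
  have df: "f differentiable (at z)" "gradient f differentiable (at z)" for z
    using f_C2 by (auto simp: twice_continuously_differentiable_def)
  have da: "(\<lambda>z. a z $ i) differentiable (at z)" "gradient (\<lambda>z. a z $ i) differentiable (at z)" for i z
    using a_C2 by (auto simp: twice_continuously_differentiable_def)
  have "(\<lambda>k. gradient f (x k)) \<longlonglongrightarrow> gradient f xstar"
    using isCont_tendsto_compose[OF differentiable_imp_continuous_within[OF df(2)] x_lim] by simp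
  moreover have "(\<lambda>k. gradient (\<lambda>z. a z $ i) (x k)) \<longlonglongrightarrow> gradient (\<lambda>z. a z $ i) xstar" for i
    using isCont_tendsto_compose[OF differentiable_imp_continuous_within[OF da(2)] x_lim] by simp
  ultimately have gl: "(\<lambda>k. grad_lagrangian f a (x k) (y k)) \<longlonglongrightarrow> grad_lagrangian f a xstar ystar"
    unfolding grad_lagrangian_eq(2)[OF df(1) da(1)] by (intro tendsto_intros y_lim)
  have "(\<lambda>k. d * \<mu> k * (l1_norm (y k) + 1)) \<longlonglongrightarrow> d * 0 * (l1_norm ystar + 1)"
    unfolding l1_norm_def by (intro tendsto_intros mu_lim y_lim)
  then have "(\<lambda>k. grad_lagrangian f a (x k) (y k)) \<longlonglongrightarrow> 0"
    by (intro Lim_null_comparison[OF dual]) simp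
  then have g0: "grad_lagrangian f a xstar ystar = 0"
    using gl LIMSEQ_unique by blast
  have "0 \<le> ystar $ i" for i
    using y_nonneg
    by (intro tendsto_lowerbound[OF tendsto_vec_nth[OF y_lim]]) (auto simp: less_eq_vec_def elim: eventually_mono)
  then have y0: "0 \<le> ystar"
    by (simp add: less_eq_vec_def)
  \<comment> \<open>The limit of \<open>y k \<bullet> s k\<close> gives one inequality of
    complementarity; the signs of \<open>a xstar\<close> and \<open>ystar\<close> give the
    other.\<close>
  have "ystar \<bullet> (- a xstar) \<le> 0 * c"
    by (rule tendsto_le[OF _ tendsto_mult_right[OF mu_lim] tendsto_inner[OF y_lim s_lim] compl_upper]) simp
  moreover have "a xstar \<bullet> ystar \<le> 0"
    unfolding inner_vec_def using feasible y0
    by (intro sum_nonpos) (auto simp: less_eq_vec_def mult_nonpos_nonneg)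
  ultimately have "a xstar \<bullet> ystar = 0"
    by (simp add: inner_commute)
  with g0 y0 show ?thesis
    by (simp add: lagrange_multiplier_def)
qed

text \<open>All terms of \<open>a x \<bullet> y\<close> are nonpositive, so a zero sum makes each of
  them vanish.\<close>

lemma complementary_component_zero:
  fixes a :: "real^'n \<Rightarrow> real^'m"
  assumes "a x \<le> 0" "lagrange_multiplier f a x y" "i \<notin> active a x"
  shows "y $ i = 0"
proof -
  have "\<forall>j\<in>UNIV. 0 \<le> - (a x $ j * y $ j)"
    using assms(1,2) by (auto simp: lagrange_multiplier_def less_eq_vec_def mult_nonpos_nonneg)
  moreover have "(\<Sum>j\<in>UNIV. - (a x $ j * y $ j)) = 0"
    using assms(2) by (simp add: lagrange_multiplier_def inner_vec_def sum_negf)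
  ultimately have "a x $ i * y $ i = 0"
    using sum_nonneg_eq_0_iff[of UNIV "\<lambda>j. - (a x $ j * y $ j)"] by auto
  then show ?thesis
    using assms(3) by (simp add: active_def)
qed

text \<open>The gradient of \<open>f\<close> cancels in the difference, which turns statements about
  Lagrangian gradients into statements about the constraints alone.\<close>

lemma multiplier_difference_gradient:
  fixes f :: "real^'n \<Rightarrow> real" and a :: "real^'n \<Rightarrow> real^'m"
  assumes f: "f differentiable (at x)"
    and a: "\<And>i. (\<lambda>z. a z $ i) differentiable (at x)"
  shows "(\<Sum>i\<in>UNIV. (y' - y) $ i *\<^sub>R gradient (\<lambda>z. a z $ i) x) =
    grad_lagrangian f a x y' - grad_lagrangian f a x y"
  unfolding grad_lagrangian_eq(2)[OF assms] by (simp add: scaleR_left_diff_distrib sum_subtractf)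

text \<open>\<open>G\<close> is left free because it is used with the constraint gradients at the
  limit point and also with those at the current iterate.\<close>

lemma inner_increment_bound:
  fixes w a a0 :: "real^'m" and G :: "'m \<Rightarrow> real^'n"
  assumes "\<And>i. \<bar>a $ i - a0 $ i - G i \<bullet> h\<bar> \<le> r"
  shows "\<bar>w \<bullet> a - w \<bullet> a0 - (\<Sum>i\<in>UNIV. w $ i *\<^sub>R G i) \<bullet> h\<bar> \<le> l1_norm w * r"
proof -
  have "w \<bullet> a - w \<bullet> a0 - (\<Sum>i\<in>UNIV. w $ i *\<^sub>R G i) \<bullet> h =
      (\<Sum>i\<in>UNIV. w $ i * (a $ i - a0 $ i - G i \<bullet> h))"
    by (simp add: inner_vec_def[of w] inner_sum_left sum_subtractf right_diff_distrib)
  also have "\<bar>\<dots>\<bar> \<le> (\<Sum>i\<in>UNIV. \<bar>w $ i\<bar> * r)"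
    by (intro order_trans[OF sum_abs] sum_mono) (simp add: abs_mult assms mult_left_mono)
  finally show ?thesis
    by (simp add: l1_norm_def sum_distrib_right)
qed

lemma quadratic_form_bound:
  fixes H :: "real^'n^'n"
  obtains K where "K \<ge> 0" "\<And>v. \<bar>v \<bullet> (H *v v)\<bar> \<le> K * (norm v)\<^sup>2"
proof -
  obtain K where K: "K \<ge> 0" "\<And>v. norm (H *v v) \<le> norm v * K"
    using bounded_linear.nonneg_bounded[OF matrix_vector_mul_bounded_linear[of H]] by blast
  have "\<bar>v \<bullet> (H *v v)\<bar> \<le> K * (norm v)\<^sup>2" for v
    using order_trans[OF Cauchy_Schwarz_ineq2 mult_left_mono[OF K(2) norm_ge_zero], of v v]
    by (simp add: power2_eq_square mult.commute mult.left_commute)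
  with K(1) show thesis
    using that by blast
qed

section \<open>Elementary consequences of the convergence hypotheses\<close>

text \<open>The second-order condition is kept out of the context, so that it appears explicitly in
  each lemma that relies on it.\<close>

locale primal_dual_sequence =
  fixes f :: "real^'n \<Rightarrow> real" and a :: "real^'n \<Rightarrow> real^'m"
    and x :: "nat \<Rightarrow> real^'n" and y s :: "nat \<Rightarrow> real^'m" and \<mu> :: "nat \<Rightarrow> real"
    and xstar :: "real^'n" and ystar :: "real^'m"
    and b c u d :: real
  assumes mu_pos: "\<forall>\<^sub>F k in sequentially. \<mu> k > 0"
    and mu_lim: "\<mu> \<longlonglongrightarrow> 0"
    and x_lim: "x \<longlonglongrightarrow> xstar"
    and feasible: "a xstar \<le> 0"
    and s_lim: "s \<longlonglongrightarrow> - a xstar"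
    and y_nonneg: "\<forall>\<^sub>F k in sequentially. 0 \<le> y k"
    and s_nonneg: "\<forall>\<^sub>F k in sequentially. 0 \<le> s k"
    and y_lim: "y \<longlonglongrightarrow> ystar"
    and b: "0 < b"
    and c: "0 \<le> c"
    and compl_lower:
      "\<forall>\<^sub>F k in sequentially. \<forall>i\<in>active a xstar. \<mu> k * b \<le> y k $ i * s k $ i"
    and compl_upper: "\<forall>\<^sub>F k in sequentially. y k \<bullet> s k \<le> \<mu> k * c"
    and u: "u \<ge> 0"
    and primal:
      "\<forall>\<^sub>F k in sequentially. \<forall>i\<in>active a xstar. \<bar>a (x k) $ i + s k $ i\<bar> \<le> \<mu> k * u"
    and d: "d \<ge> 0"
    and dual:
      "\<forall>\<^sub>F k in sequentially.
         norm (grad_lagrangian f a (x k) (y k)) \<le> d * \<mu> k * (l1_norm (y k) + 1)"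
    and f_C2: "twice_continuously_differentiable f"
    and a_C2: "\<forall>i. twice_continuously_differentiable (\<lambda>z. a z $ i)"
begin

abbreviation h :: "nat \<Rightarrow> real^'n" where
  "h k \<equiv> x k - xstar"

lemma multiplier: "lagrange_multiplier f a xstar ystar"
  by (rule lagrange_multiplier_limit[OF mu_lim x_lim feasible s_lim y_nonneg y_lim compl_upper
      dual f_C2 a_C2])

lemma df: "f differentiable (at z)" "gradient f differentiable (at z)"
  using f_C2 by (auto simp: twice_continuously_differentiable_def)

lemma da:
  "(\<lambda>z. a z $ i) differentiable (at z)" "gradient (\<lambda>z. a z $ i) differentiable (at z)"
  using a_C2 by (auto simp: twice_continuously_differentiable_def)

lemma h_lim: "h \<longlonglongrightarrow> 0"
  using x_lim LIM_zero by blast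

lemma norm_h_lim: "(\<lambda>k. norm (h k)) \<longlonglongrightarrow> 0"
  using h_lim tendsto_norm_zero by blast

lemma eventually_at_x: "(\<forall>\<^sub>F z in nhds xstar. P z) \<Longrightarrow> \<forall>\<^sub>F k in sequentially. P (x k)"
  using x_lim unfolding filterlim_iff by blast

lemma complementarity_component:
  "\<forall>\<^sub>F k in sequentially. \<forall>i. 0 \<le> y k $ i * s k $ i \<and> y k $ i * s k $ i \<le> \<mu> k * c"
  using y_nonneg s_nonneg compl_upper
proof eventually_elim
  case (elim k)
  have nn: "0 \<le> y k $ i * s k $ i" for i
    using elim(1,2) by (simp add: less_eq_vec_def)
  then have "y k $ i * s k $ i \<le> y k \<bullet> s k" for i
    unfolding inner_vec_def inner_real_def by (intro member_le_sum) auto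
  with nn elim(3) show ?case
    by (meson order_trans)
qed

lemma l1_norm_bounded: "\<forall>\<^sub>F k in sequentially. l1_norm (y k) \<le> l1_norm ystar + 1"
proof -
  have "(\<lambda>k. l1_norm (y k)) \<longlonglongrightarrow> l1_norm ystar"
    unfolding l1_norm_def by (intro tendsto_intros y_lim)
  from order_tendstoD(2)[OF this, of "l1_norm ystar + 1"] show ?thesis
    by (auto elim: eventually_mono)
qed

lemma l1_norm_diff_lim: "(\<lambda>k. l1_norm (y k - ystar)) \<longlonglongrightarrow> 0"
proof -
  have "(\<lambda>k. l1_norm (y k - ystar)) \<longlonglongrightarrow> l1_norm (ystar - ystar)"
    unfolding l1_norm_def by (intro tendsto_intros y_lim)
  then show ?thesis
    by (simp add: l1_norm_def)
qed

section \<open>Curvature of the Lagrangian along the increments \<open>h k\<close>\<close>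

text \<open>Gradients at \<open>xstar\<close> serve the critical cone and the comparison of two
  exact multipliers; gradients at \<open>x k\<close> serve the increment of
  \<open>y k - ystar\<close>.\<close>

lemma constraint_expansion:
  obtains C where "C \<ge> 0"
    "\<forall>\<^sub>F k in sequentially. \<forall>i.
        \<bar>a (x k) $ i - a xstar $ i - gradient (\<lambda>z. a z $ i) xstar \<bullet> h k\<bar> \<le> C * (norm (h k))\<^sup>2
      \<and> \<bar>a (x k) $ i - a xstar $ i - gradient (\<lambda>z. a z $ i) (x k) \<bullet> h k\<bar> \<le> C * (norm (h k))\<^sup>2"
proof (rule gradient_error_quadratic_vec[of a xstar, OF da])
  fix C assume C: "C \<ge> 0" "\<forall>\<^sub>F z in nhds xstar. \<forall>i.
        \<bar>a z $ i - a xstar $ i - gradient (\<lambda>z. a z $ i) xstar \<bullet> (z - xstar)\<bar> \<le> C * (norm (z - xstar))\<^sup>2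
      \<and> \<bar>a z $ i - a xstar $ i - gradient (\<lambda>z. a z $ i) z \<bullet> (z - xstar)\<bar> \<le> C * (norm (z - xstar))\<^sup>2"
  show thesis
    by (rule that[OF C(1) eventually_at_x[OF C(2)]])
qed

text \<open>Once \<open>\<mu>\<close> is dominated by \<open>|h|\<^sup>2\<close>, all violations of the critical cone
  inequalities at \<open>h\<close> are of second order.\<close>

lemma near_critical_cone:
  obtains C where "C \<ge> 0"
    "\<forall>\<^sub>F k in sequentially. \<mu> k \<le> (norm (h k))\<^sup>2 \<longrightarrow>
       (\<forall>p\<in>insert (gradient f xstar) ((\<lambda>i. gradient (\<lambda>z. a z $ i) xstar) ` active a xstar).
          p \<bullet> h k \<le> C * (norm (h k))\<^sup>2)"
proof -
  let ?g = "\<lambda>i. gradient (\<lambda>z. a z $ i) xstar"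
  obtain C where C: "C \<ge> 0"
    "\<forall>\<^sub>F k in sequentially. \<forall>i.
        \<bar>a (x k) $ i - a xstar $ i - ?g i \<bullet> h k\<bar> \<le> C * (norm (h k))\<^sup>2
      \<and> \<bar>a (x k) $ i - a xstar $ i - gradient (\<lambda>z. a z $ i) (x k) \<bullet> h k\<bar> \<le> C * (norm (h k))\<^sup>2"
    using constraint_expansion by blast
  \<comment> \<open>For \<open>ystar $ i > 0\<close>, \<open>2 * c\<close> comes from
    \<open>ystar $ i * s k $ i \<le> 2 * (y k $ i * s k $ i)\<close>, and
    \<open>ystar $ i * (u + C)\<close> from replacing \<open>s k $ i\<close> by minus the linearized
    constraint.\<close>
  define B where "B i = 2 * c + ystar $ i * (u + C)" for i
  have y0: "ystar $ i \<ge> 0" for i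
    using multiplier by (simp add: lagrange_multiplier_def less_eq_vec_def)
  have B: "B i \<ge> 0" for i
    using y0 u C(1) c by (simp add: B_def)
  have half: "\<forall>\<^sub>F k in sequentially. \<forall>i. ystar $ i > 0 \<longrightarrow> y k $ i > ystar $ i / 2"
  proof (rule eventually_all_finite)
    show "\<forall>\<^sub>F k in sequentially. ystar $ i > 0 \<longrightarrow> y k $ i > ystar $ i / 2" for i
    proof (cases "ystar $ i > 0")
      case True
      then show ?thesis
        using order_tendstoD(1)[OF tendsto_vec_nth[OF y_lim], of "ystar $ i / 2" i]
        by (auto elim: eventually_mono)
    qed simp
  qed
  \<comment> \<open>Stationarity turns the upper bound sought for
    \<open>gradient f xstar \<bullet> h k\<close> into lower bounds for the linearized constraints,
    weighted by \<open>ystar\<close>.\<close>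
  have gf: "gradient f xstar \<bullet> v = (\<Sum>i\<in>UNIV. ystar $ i * - (?g i \<bullet> v))" for v
  proof -
    have "(gradient f xstar + (\<Sum>i\<in>UNIV. ystar $ i *\<^sub>R ?g i)) \<bullet> v = 0"
      using multiplier grad_lagrangian_eq(2)[OF df(1) da(1), of xstar ystar]
      by (simp add: lagrange_multiplier_def)
    then show ?thesis
      by (simp add: inner_add_left inner_sum_left sum_negf)
  qed
  have "\<forall>\<^sub>F k in sequentially. \<mu> k \<le> (norm (h k))\<^sup>2 \<longrightarrow>
       (\<forall>p\<in>insert (gradient f xstar) (?g ` active a xstar).
          p \<bullet> h k \<le> (u + C + sum B UNIV) * (norm (h k))\<^sup>2)"
    using C(2) half complementarity_component primal s_nonneg mu_pos
  proof eventually_elim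
    case (elim k)
    let ?n2 = "(norm (h k))\<^sup>2"
    have SB: "0 \<le> sum B UNIV * ?n2"
      using B by (simp add: sum_nonneg)
    show ?case
    proof (rule impI)
      assume mu: "\<mu> k \<le> ?n2"
      have mu_u: "\<mu> k * u \<le> u * ?n2" and mu_c: "\<mu> k * c \<le> c * ?n2"
        using mult_right_mono[OF mu u] mult_right_mono[OF mu c] by (simp_all add: mult.commute)
      \<comment> \<open>On active constraints the linearization equals \<open>- s k $ i\<close> up
        to the Taylor error (\<open>C\<close>) and the primal residual (\<open>u\<close>, with \<mu>
        at most |h|^2).\<close>
      have ga: "\<bar>?g i \<bullet> h k + s k $ i\<bar> \<le> (u + C) * ?n2" if "i \<in> active a xstar" for i
      proof -
        have "a xstar $ i = 0"
          using that by (simp add: active_def)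
        then have "\<bar>a (x k) $ i - ?g i \<bullet> h k\<bar> \<le> C * ?n2"
          using elim(1) by (metis diff_zero)
        moreover have "\<bar>a (x k) $ i + s k $ i\<bar> \<le> u * ?n2"
          using elim(4) that mu_u order_trans by blast
        ultimately show ?thesis
          by (simp add: distrib_right)
      qed
      have "?g i \<bullet> h k \<le> (u + C + sum B UNIV) * ?n2" if "i \<in> active a xstar" for i
      proof -
        have "0 \<le> s k $ i"
          using elim(5) by (simp add: less_eq_vec_def)
        then have "?g i \<bullet> h k \<le> (u + C) * ?n2"
          using ga[OF that] by linarith
        then show ?thesis
          using SB by (simp add: distrib_right)
      qed
      moreover have "ystar $ i * - (?g i \<bullet> h k) \<le> B i * ?n2" for i
      proof (cases "ystar $ i > 0")
        case True
        then have i: "i \<in> active a xstar"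
          using complementary_component_zero[OF feasible multiplier, of i] by auto
        have "0 \<le> s k $ i"
          using elim(5) by (simp add: less_eq_vec_def)
        then have "ystar $ i / 2 * s k $ i \<le> y k $ i * s k $ i"
          using elim(2) True by (intro mult_right_mono) (auto intro: less_imp_le)
        then have ys: "ystar $ i * s k $ i \<le> 2 * c * ?n2"
          using elim(3)[rule_format, of i] mu_c by simp
        have "- (?g i \<bullet> h k) \<le> s k $ i + (u + C) * ?n2"
          using ga[OF i] by linarith
        then have "ystar $ i * - (?g i \<bullet> h k) \<le> ystar $ i * (s k $ i + (u + C) * ?n2)"
          using True by (intro mult_left_mono) auto
        also have "\<dots> \<le> B i * ?n2"
          using ys by (simp add: B_def algebra_simps)
        finally show ?thesis .
      next
        case False
        then show ?thesis
          using y0[of i] B[of i] by (simp add: order_antisym)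
      qed
      then have "gradient f xstar \<bullet> h k \<le> sum B UNIV * ?n2"
        unfolding gf sum_distrib_right by (intro sum_mono)
      moreover have "0 \<le> (u + C) * ?n2"
        using u C(1) by simp
      ultimately show "\<forall>p\<in>insert (gradient f xstar) (?g ` active a xstar).
          p \<bullet> h k \<le> (u + C + sum B UNIV) * ?n2"
        by (auto simp: distrib_right)
    qed
  qed
  then show thesis
    using that[of "u + C + sum B UNIV"] u C(1) B by (simp add: sum_nonneg)
qed

text \<open>If \<mu> is at most |h|^2, then \<open>h k\<close> is close to the critical cone and
  curvature is available; otherwise the whole form is O(\<mu>).\<close>

lemma hessian_lower_bound:
  assumes "second_order_sufficient f a xstar ystar"
  obtains lam K where "lam > 0" "K \<ge> 0"
    "\<forall>\<^sub>F k in sequentially. h k \<bullet> (hessian_lagrangian f a xstar ystar *v h k)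
       \<ge> lam * (norm (h k))\<^sup>2 - K * \<mu> k"
proof -
  let ?H = "hessian_lagrangian f a xstar ystar"
  let ?J = "insert (gradient f xstar) ((\<lambda>i. gradient (\<lambda>z. a z $ i) xstar) ` active a xstar)"
  obtain lam where lam: "lam > 0"
    "\<And>v. (\<forall>p\<in>?J. p \<bullet> v \<le> 0) \<Longrightarrow> v \<bullet> (?H *v v) \<ge> lam * (norm v)\<^sup>2"
    using assms unfolding second_order_sufficient_def by auto
  obtain \<delta> where \<delta>: "\<delta> > 0"
    "\<And>v. (\<forall>p\<in>?J. p \<bullet> v \<le> \<delta> * norm v) \<Longrightarrow> v \<bullet> (?H *v v) \<ge> lam / 2 * (norm v)\<^sup>2"
    using second_order_near_cone[where J = ?J and H = ?H and lam = lam] lam by blast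
  obtain C where C: "C \<ge> 0"
    "\<forall>\<^sub>F k in sequentially. \<mu> k \<le> (norm (h k))\<^sup>2 \<longrightarrow> (\<forall>p\<in>?J. p \<bullet> h k \<le> C * (norm (h k))\<^sup>2)"
    using near_critical_cone by blast
  obtain K where K: "K \<ge> 0" "\<And>v. \<bar>v \<bullet> (?H *v v)\<bar> \<le> K * (norm v)\<^sup>2"
    using quadratic_form_bound[of ?H] by blast
  \<comment> \<open>A cone violation of size C |h|^2 is (C |h|) |h|, and its first factor eventually
    drops below \<delta>.\<close>
  have "(\<lambda>k. C * norm (h k)) \<longlonglongrightarrow> C * 0"
    by (intro tendsto_intros norm_h_lim)
  then have "\<forall>\<^sub>F k in sequentially. C * norm (h k) < \<delta>"
    using \<delta>(1) by (auto dest: order_tendstoD(2))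
  then have "\<forall>\<^sub>F k in sequentially. h k \<bullet> (?H *v h k)
      \<ge> lam / 2 * (norm (h k))\<^sup>2 - (K + lam / 2) * \<mu> k"
    using C(2) mu_pos
  proof eventually_elim
    case (elim k)
    show ?case
    proof (cases "\<mu> k \<le> (norm (h k))\<^sup>2")
      case True
      have "C * (norm (h k))\<^sup>2 \<le> \<delta> * norm (h k)"
        using mult_right_mono[OF less_imp_le[OF elim(1)] norm_ge_zero[of "h k"]]
        by (simp add: power2_eq_square)
      then have "\<forall>p\<in>?J. p \<bullet> h k \<le> \<delta> * norm (h k)"
        using elim(2) True order_trans by blast
      moreover have "0 \<le> (K + lam / 2) * \<mu> k"
        using K(1) lam(1) elim(3) by simp
      ultimately show ?thesis
        using \<delta>(2)[of "h k"] by linarith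
    next
      case False
      \<comment> \<open>Here the form is only known to be at least -K |h|^2; adding and subtracting
        (lam / 2) |h|^2 explains the coefficient of \<mu>.\<close>
      then have "(K + lam / 2) * (norm (h k))\<^sup>2 \<le> (K + lam / 2) * \<mu> k"
        using K(1) lam(1) by (intro mult_left_mono) auto
      then show ?thesis
        using K(2)[of "h k"] by (simp add: distrib_right)
    qed
  qed
  then show thesis
    using that[of "lam / 2" "K + lam / 2"] lam(1) K(1) by simp
qed

section \<open>Lagrangian gradients and multiplier differences along the sequence\<close>

text \<open>The first-order term of the expansion disappears because \<open>ystar\<close> makes the
  Lagrangian stationary at \<open>xstar\<close>.\<close>

lemma lagrangian_gradient_expansion:
  assumes "e > 0"
  shows "\<forall>\<^sub>F k in sequentially. grad_lagrangian f a (x k) ystar \<bullet> h k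
    \<ge> h k \<bullet> (hessian_lagrangian f a xstar ystar *v h k) - e * (norm (h k))\<^sup>2"
proof -
  let ?P = "\<lambda>z. lagrangian f a z ystar"
  have "gradient ?P = (\<lambda>z. gradient f z + (\<Sum>i\<in>UNIV. ystar $ i *\<^sub>R gradient (\<lambda>z. a z $ i) z))"
    using grad_lagrangian_eq(2)[OF df(1) da(1)] by (intro ext) (simp add: grad_lagrangian_def)
  then have "gradient ?P differentiable (at xstar)"
    by (simp add: df da)
  from gradient_expansion_along_increment[OF this assms]
  have "\<forall>\<^sub>F z in nhds xstar. grad_lagrangian f a z ystar \<bullet> (z - xstar)
      \<ge> (z - xstar) \<bullet> (hessian_lagrangian f a xstar ystar *v (z - xstar)) - e * (norm (z - xstar))\<^sup>2"
  proof eventually_elim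
    case (elim z)
    have "grad_lagrangian f a xstar ystar = 0"
      using multiplier by (simp add: lagrange_multiplier_def)
    with elim show ?case
      unfolding grad_lagrangian_def hessian_lagrangian_def by simp
  qed
  then show ?thesis
    by (rule eventually_at_x)
qed

text \<open>The dual residual is O(\<mu>) because \<open>y\<close> is bounded, and eventually |h| <
  1.\<close>

lemma dual_residual_bound:
  "\<forall>\<^sub>F k in sequentially. \<bar>grad_lagrangian f a (x k) (y k) \<bullet> h k\<bar> \<le> d * (l1_norm ystar + 2) * \<mu> k"
proof -
  have "\<forall>\<^sub>F k in sequentially. norm (h k) < 1"
    using norm_h_lim by (rule order_tendstoD) simp
  with dual l1_norm_bounded mu_pos show ?thesis
  proof eventually_elim
    case (elim k)
    let ?g = "grad_lagrangian f a (x k) (y k)"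
    have "\<bar>?g \<bullet> h k\<bar> \<le> norm ?g * norm (h k)"
      by (rule Cauchy_Schwarz_ineq2)
    also have "\<dots> \<le> norm ?g"
      using elim(4) by (simp add: mult_left_le)
    also have "\<dots> \<le> d * \<mu> k * (l1_norm (y k) + 1)"
      by (rule elim(1))
    also have "\<dots> \<le> d * \<mu> k * (l1_norm ystar + 2)"
      using elim(2,3) d by (intro mult_left_mono) auto
    finally show ?case
      by (simp add: mult.commute mult.left_commute)
  qed
qed

text \<open>The difference of the constraint terms is controlled without expanding \<open>f\<close> itself:
  \<open>(y' - y\<^sup>*) \<bullet> a\<close> vanishes to first order at \<open>x\<^sup>*\<close>, and the increment of
  \<open>(y\<^sup>k - y\<^sup>*) \<bullet> a\<close> is, up to \<open>o(|h|\<^sup>2)\<close>, the difference of two Lagrangian gradients at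
  \<open>x\<^sup>k\<close> applied to \<open>h\<close>. Moving only a small step towards \<open>y'\<close> makes its contribution
  smaller than the curvature of the Lagrangian.\<close>

lemma multiplier_difference_lower_bound:
  assumes sosc: "second_order_sufficient f a xstar ystar"
    and y': "lagrange_multiplier f a xstar y'"
  obtains \<epsilon> M where "0 < \<epsilon>" "\<epsilon> \<le> 1" "M \<ge> 0"
    "\<forall>\<^sub>F k in sequentially. (ystar + \<epsilon> *\<^sub>R (y' - ystar) - y k) \<bullet> a (x k) \<ge> - M * \<mu> k"
proof -
  let ?H = "hessian_lagrangian f a xstar ystar"
  let ?g = "\<lambda>i z. gradient (\<lambda>z. a z $ i) z"
  obtain lam K where lam: "lam > 0" and K: "K \<ge> 0"
    and curv: "\<forall>\<^sub>F k in sequentially. h k \<bullet> (?H *v h k) \<ge> lam * (norm (h k))\<^sup>2 - K * \<mu> k"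
    using hessian_lower_bound[OF sosc] by blast
  obtain C where C: "C \<ge> 0" "\<forall>\<^sub>F k in sequentially. \<forall>i.
        \<bar>a (x k) $ i - a xstar $ i - ?g i xstar \<bullet> h k\<bar> \<le> C * (norm (h k))\<^sup>2
      \<and> \<bar>a (x k) $ i - a xstar $ i - ?g i (x k) \<bullet> h k\<bar> \<le> C * (norm (h k))\<^sup>2"
    using constraint_expansion by blast
  define Z where "Z = l1_norm (y' - ystar) * C"
  have Z: "Z \<ge> 0"
    using C(1) by (simp add: Z_def l1_norm_def sum_nonneg)
  \<comment> \<open>The curvature lam |h|^2 is spent as follows: lam / 2 on expanding the Lagrangian
    gradient, lam / 4 on the increment of \<open>y k - ystar\<close>, and lam / 4 on the step of
    length \<epsilon>. The \<open>+ 1\<close> guards against \<open>Z = 0\<close>.\<close>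
  define \<epsilon> where "\<epsilon> = min 1 (lam / 4 / (Z + 1))"
  have \<epsilon>: "0 < \<epsilon>" "\<epsilon> \<le> 1"
    using lam Z by (simp_all add: \<epsilon>_def)
  have "\<epsilon> \<le> lam / 4 / (Z + 1)"
    by (simp add: \<epsilon>_def)
  then have "\<epsilon> * (Z + 1) \<le> lam / 4"
    using Z by (subst (asm) pos_le_divide_eq) auto
  then have \<epsilon>Z: "\<epsilon> * Z \<le> lam / 4"
    using \<epsilon>(1) by (simp add: distrib_left)
  define M where "M = K + d * (l1_norm ystar + 2)"
  have M: "M \<ge> 0"
    using K d by (simp add: M_def l1_norm_def sum_nonneg)
  have "(\<lambda>k. l1_norm (y k - ystar) * C) \<longlonglongrightarrow> 0 * C"
    by (intro tendsto_intros l1_norm_diff_lim)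
  then have W: "\<forall>\<^sub>F k in sequentially. l1_norm (y k - ystar) * C < lam / 4"
    by (rule order_tendstoD(2)) (use lam in simp)
  have half_lam: "lam / 2 > 0"
    using lam by simp
  have comp: "ystar \<bullet> a xstar = 0" "y' \<bullet> a xstar = 0"
    using multiplier y' by (simp_all add: lagrange_multiplier_def inner_commute)
  have "\<forall>\<^sub>F k in sequentially. (ystar + \<epsilon> *\<^sub>R (y' - ystar) - y k) \<bullet> a (x k) \<ge> - M * \<mu> k"
    using curv C(2) W lagrangian_gradient_expansion[OF half_lam] dual_residual_bound y_nonneg
  proof eventually_elim
    case (elim k)
    let ?n2 = "(norm (h k))\<^sup>2"
    have "grad_lagrangian f a xstar y' = 0" "grad_lagrangian f a xstar ystar = 0"
      using multiplier y' by (simp_all add: lagrange_multiplier_def)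
    then have "(\<Sum>i\<in>UNIV. (y' - ystar) $ i *\<^sub>R ?g i xstar) = 0"
      by (simp only: multiplier_difference_gradient[OF df(1) da(1)] diff_self)
    then have "\<bar>(y' - ystar) \<bullet> a (x k)\<bar> \<le> Z * ?n2"
      using inner_increment_bound[of "a (x k)" "a xstar" "\<lambda>i. ?g i xstar" "h k" "C * ?n2" "y' - ystar"]
        elim(2) comp by (simp add: inner_diff_left Z_def)
    then have "- (Z * ?n2) \<le> (y' - ystar) \<bullet> a (x k)"
      by linarith
    then have "\<epsilon> * - (Z * ?n2) \<le> \<epsilon> * ((y' - ystar) \<bullet> a (x k))"
      using \<epsilon>(1) by (intro mult_left_mono) auto
    moreover have "\<epsilon> * Z * ?n2 \<le> lam / 4 * ?n2"
      using \<epsilon>Z by (intro mult_right_mono) auto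
    ultimately have 1: "\<epsilon> * ((y' - ystar) \<bullet> a (x k)) \<ge> - (lam / 4 * ?n2)"
      by simp
    \<comment> \<open>\<open>y k\<close> need not be complementary to \<open>a xstar\<close>, but
      the sign is the favourable one for an upper bound on
      \<open>(y k - ystar) \<bullet> a (x k)\<close>.\<close>
    have "y k \<bullet> a xstar \<le> 0"
      unfolding inner_vec_def using feasible elim(6)
      by (intro sum_nonpos) (auto simp: less_eq_vec_def mult_nonneg_nonpos)
    then have "(y k - ystar) \<bullet> a xstar \<le> 0"
      using comp by (simp add: inner_diff_left)
    moreover have "\<bar>(y k - ystar) \<bullet> a (x k) - (y k - ystar) \<bullet> a xstar -
        (grad_lagrangian f a (x k) (y k) - grad_lagrangian f a (x k) ystar) \<bullet> h k\<bar>
        \<le> l1_norm (y k - ystar) * (C * ?n2)"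
      using inner_increment_bound[of "a (x k)" "a xstar" "\<lambda>i. ?g i (x k)" "h k" "C * ?n2" "y k - ystar"]
        elim(2) unfolding multiplier_difference_gradient[OF df(1) da(1)] by blast
    moreover have "l1_norm (y k - ystar) * (C * ?n2) \<le> lam / 4 * ?n2"
      using mult_right_mono[OF less_imp_le[OF elim(3)], of ?n2] by (simp add: mult.assoc)
    moreover have "\<bar>grad_lagrangian f a (x k) (y k) \<bullet> h k\<bar> \<le> d * (l1_norm ystar + 2) * \<mu> k"
      by (rule elim(5))
    moreover have "grad_lagrangian f a (x k) ystar \<bullet> h k \<ge> lam / 2 * ?n2 - K * \<mu> k"
      using elim(1,4) by linarith
    ultimately have "(y k - ystar) \<bullet> a (x k)
        \<le> d * (l1_norm ystar + 2) * \<mu> k + lam / 4 * ?n2 - (lam / 2 * ?n2 - K * \<mu> k)"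
      unfolding inner_diff_left by linarith
    moreover have "M * \<mu> k = K * \<mu> k + d * (l1_norm ystar + 2) * \<mu> k"
      by (simp only: M_def distrib_right)
    ultimately show ?case
      using 1 by (simp add: inner_diff_left inner_add_left)
  qed
  with \<epsilon> M show thesis
    using that by blast
qed

section \<open>Decay of slacks and maximal complementarity\<close>

text \<open>Up to O(\<mu>), \<open>yt \<bullet> s k\<close> is at most
  \<open>- (yt \<bullet> a (x k))\<close>, hence at most \<open>- (y k \<bullet> a (x k))\<close>,
  which is itself bounded by O(\<mu>). All terms of \<open>yt \<bullet> s k\<close> are nonnegative
  and \<open>yt $ i > 0\<close>, so the single slack inherits the bound.\<close>

lemma active_slack_bound:
  assumes sosc: "second_order_sufficient f a xstar ystar"
    and y': "lagrange_multiplier f a xstar y'" and pos: "y' $ i > 0"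
  obtains M where "\<forall>\<^sub>F k in sequentially. s k $ i \<le> M * \<mu> k"
proof -
  obtain \<epsilon> M where \<epsilon>: "0 < \<epsilon>" "\<epsilon> \<le> 1" and M: "M \<ge> 0"
    and lower: "\<forall>\<^sub>F k in sequentially. (ystar + \<epsilon> *\<^sub>R (y' - ystar) - y k) \<bullet> a (x k) \<ge> - M * \<mu> k"
    using multiplier_difference_lower_bound[OF sosc y'] by blast
  define yt where "yt = ystar + \<epsilon> *\<^sub>R (y' - ystar)"
  have yt_eq: "yt $ j = (1 - \<epsilon>) * ystar $ j + \<epsilon> * y' $ j" for j
    by (simp add: yt_def algebra_simps)
  have nonneg: "ystar $ j \<ge> 0" "y' $ j \<ge> 0" for j
    using multiplier y' by (simp_all add: lagrange_multiplier_def less_eq_vec_def)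
  have yt_nonneg: "yt $ j \<ge> 0" for j
    unfolding yt_eq using \<epsilon> nonneg by simp
  have yt_pos: "yt $ i > 0"
    unfolding yt_eq using \<epsilon> nonneg pos by (intro add_nonneg_pos) auto
  have yt_inactive: "yt $ j = 0" if "j \<notin> active a xstar" for j
    unfolding yt_eq
    using complementary_component_zero[OF feasible _ that] multiplier y' by simp
  \<comment> \<open>The residual condition covers active constraints only. For an inactive one,
    \<open>2 * s k $ j + a (x k) $ j\<close> tends to \<open>- a xstar $ j > 0\<close>; the factor 2
    provides this strict margin.\<close>
  have slack: "\<forall>\<^sub>F k in sequentially. \<forall>j. j \<notin> active a xstar \<longrightarrow> - (a (x k) $ j) \<le> 2 * s k $ j"
  proof (rule eventually_all_finite)
    fix j
    show "\<forall>\<^sub>F k in sequentially. j \<notin> active a xstar \<longrightarrow> - (a (x k) $ j) \<le> 2 * s k $ j"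
    proof (cases "j \<in> active a xstar")
      case False
      then have neg: "a xstar $ j < 0"
        using feasible by (simp add: active_def less_eq_vec_def order_less_le)
      have "(\<lambda>k. a (x k) $ j) \<longlonglongrightarrow> a xstar $ j"
        using isCont_tendsto_compose[OF differentiable_imp_continuous_within[OF da(1)] x_lim] by simp
      then have "(\<lambda>k. 2 * s k $ j + a (x k) $ j) \<longlonglongrightarrow> 2 * (- a xstar) $ j + a xstar $ j"
        by (intro tendsto_add[OF tendsto_mult_left[OF tendsto_vec_nth[OF s_lim]]])
      then have "\<forall>\<^sub>F k in sequentially. 0 < 2 * s k $ j + a (x k) $ j"
        using neg by (intro order_tendstoD(1)) auto
      then show ?thesis
        by (auto elim: eventually_mono)
    qed simp
  qed
  \<comment> \<open>In order: residual weighted by \<open>yt\<close>, bound on the multiplier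
    difference, twice \<open>y k \<bullet> s k\<close>, residual weighted by
    \<open>y k\<close>.\<close>
  define B where "B = l1_norm yt * u + M + 2 * c + (l1_norm ystar + 1) * u"
  have "\<forall>\<^sub>F k in sequentially. s k $ i \<le> B / yt $ i * \<mu> k"
    using lower slack primal complementarity_component compl_upper l1_norm_bounded
      y_nonneg s_nonneg mu_pos
  proof eventually_elim
    case (elim k)
    have y: "y k $ j \<ge> 0" and s: "s k $ j \<ge> 0" for j
      using elim(7,8) by (simp_all add: less_eq_vec_def)
    have "yt $ j * s k $ j \<le> \<bar>yt $ j\<bar> * (\<mu> k * u) - yt $ j * a (x k) $ j" for j
    proof (cases "j \<in> active a xstar")
      case True
      then have "\<bar>a (x k) $ j + s k $ j\<bar> \<le> \<mu> k * u"
        using elim(3) by blast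
      then have "s k $ j \<le> \<mu> k * u - a (x k) $ j"
        by linarith
      from mult_left_mono[OF this yt_nonneg[of j]] show ?thesis
        using yt_nonneg[of j] by (simp add: right_diff_distrib)
    qed (simp add: yt_inactive)
    then have "yt \<bullet> s k \<le> (\<Sum>j\<in>UNIV. \<bar>yt $ j\<bar> * (\<mu> k * u) - yt $ j * a (x k) $ j)"
      unfolding inner_vec_def inner_real_def by (rule sum_mono)
    then have 1: "yt \<bullet> s k \<le> l1_norm yt * (\<mu> k * u) - yt \<bullet> a (x k)"
      by (simp add: sum_subtractf sum_distrib_right l1_norm_def inner_vec_def)
    have "- (y k $ j * a (x k) $ j) \<le> 2 * (y k $ j * s k $ j) + \<bar>y k $ j\<bar> * (\<mu> k * u)" for j
    proof -
      have mu_u: "0 \<le> \<mu> k * u"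
        using elim(9) u by simp
      have "- (a (x k) $ j) \<le> 2 * s k $ j + \<mu> k * u"
      proof (cases "j \<in> active a xstar")
        case True
        then have "\<bar>a (x k) $ j + s k $ j\<bar> \<le> \<mu> k * u"
          using elim(3) by blast
        then show ?thesis
          using s[of j] by linarith
      next
        case False
        then have "- (a (x k) $ j) \<le> 2 * s k $ j"
          using elim(2) by blast
        with mu_u show ?thesis
          by linarith
      qed
      from mult_left_mono[OF this y[of j]] show ?thesis
        using y[of j] by (simp add: distrib_left mult.left_commute)
    qed
    then have "(\<Sum>j\<in>UNIV. - (y k $ j * a (x k) $ j))
        \<le> (\<Sum>j\<in>UNIV. 2 * (y k $ j * s k $ j) + \<bar>y k $ j\<bar> * (\<mu> k * u))"
      by (rule sum_mono)
    then have 2: "- (y k \<bullet> a (x k)) \<le> 2 * (y k \<bullet> s k) + l1_norm (y k) * (\<mu> k * u)"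
      by (simp add: sum.distrib sum_negf sum_distrib_right sum_distrib_left l1_norm_def inner_vec_def)
    have 3: "l1_norm (y k) * (\<mu> k * u) \<le> (l1_norm ystar + 1) * (\<mu> k * u)"
      using elim(6,9) u by (intro mult_right_mono) auto
    have "yt \<bullet> a (x k) - y k \<bullet> a (x k) \<ge> - M * \<mu> k"
      using elim(1) by (simp add: yt_def inner_diff_left)
    with 1 2 3 elim(5) have "yt \<bullet> s k
        \<le> l1_norm yt * (\<mu> k * u) + M * \<mu> k + 2 * (\<mu> k * c) + (l1_norm ystar + 1) * (\<mu> k * u)"
      by linarith
    also have "\<dots> = B * \<mu> k"
      by (simp add: B_def algebra_simps)
    finally have "yt \<bullet> s k \<le> B * \<mu> k" .
    moreover have "yt $ i * s k $ i \<le> yt \<bullet> s k"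
      unfolding inner_vec_def inner_real_def using yt_nonneg s by (intro member_le_sum) auto
    ultimately show ?case
      using yt_pos by (simp add: field_simps)
  qed
  then show thesis
    by (rule that)
qed

text \<open>Inserting the slack bound into the lower complementarity bound and cancelling \<mu>
  leaves an inequality that survives the limit.\<close>

lemma multiplier_maximally_complementary:
  assumes sosc: "second_order_sufficient f a xstar ystar"
  shows "maximally_complementary f a xstar ystar"
  unfolding maximally_complementary_def
proof (intro allI impI)
  fix i
  assume "\<exists>y'. lagrange_multiplier f a xstar y' \<and> y' $ i > 0"
  then obtain y' where y': "lagrange_multiplier f a xstar y'" "y' $ i > 0"
    by blast
  then have i: "i \<in> active a xstar"
    using complementary_component_zero[OF feasible y'(1), of i] by auto
  obtain M where M: "\<forall>\<^sub>F k in sequentially. s k $ i \<le> M * \<mu> k"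
    using active_slack_bound[OF sosc y'] by blast
  have "\<forall>\<^sub>F k in sequentially. b \<le> M * y k $ i"
    using M compl_lower mu_pos y_nonneg
  proof eventually_elim
    case (elim k)
    have "\<mu> k * b \<le> y k $ i * s k $ i"
      using elim(2) i by blast
    also have "\<dots> \<le> y k $ i * (M * \<mu> k)"
      using elim(1,4) by (intro mult_left_mono) (auto simp: less_eq_vec_def)
    finally have "\<mu> k * b \<le> \<mu> k * (M * y k $ i)"
      by (simp add: mult.commute mult.left_commute)
    then show ?case
      using elim(3) by simp
  qed
  moreover have "(\<lambda>k. M * y k $ i) \<longlonglongrightarrow> M * ystar $ i"
    by (intro tendsto_intros y_lim)
  ultimately have "b \<le> M * ystar $ i"
    by (intro tendsto_lowerbound) auto
  \<comment> \<open>The sign of \<open>M\<close> is not known, so this inequality only excludes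
    zero; nonnegativity comes from \<open>multiplier\<close>.\<close>
  then have "ystar $ i \<noteq> 0"
    using b by auto
  moreover have "ystar $ i \<ge> 0"
    using multiplier by (simp add: lagrange_multiplier_def less_eq_vec_def)
  ultimately show "ystar $ i > 0"
    by simp
qed

end

text \<open>That \<open>ystar\<close> is a multiplier is derived from the limits and included as the
  first conjunct.\<close>

theorem theorem4:
  fixes f :: "real^'n \<Rightarrow> real" and a :: "real^'n \<Rightarrow> real^'m"
    and x :: "nat \<Rightarrow> real^'n" and y s :: "nat \<Rightarrow> real^'m" and \<mu> :: "nat \<Rightarrow> real"
    and xstar :: "real^'n" and ystar :: "real^'m"
    and b c u d :: real
  assumes mu_pos: "\<forall>\<^sub>F k in sequentially. \<mu> k > 0"
    and mu_lim: "\<mu> \<longlonglongrightarrow> 0"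
    and x_lim: "x \<longlonglongrightarrow> xstar"
    and feasible: "a xstar \<le> 0"
    and s_lim: "s \<longlonglongrightarrow> - a xstar"
    and y_nonneg: "\<forall>\<^sub>F k in sequentially. 0 \<le> y k"
    and s_nonneg: "\<forall>\<^sub>F k in sequentially. 0 \<le> s k"
    and y_lim: "y \<longlonglongrightarrow> ystar"
    and bc: "0 < b" "b \<le> c"
    and compl_lower:
      "\<forall>\<^sub>F k in sequentially. \<forall>i\<in>active a xstar. \<mu> k * b \<le> y k $ i * s k $ i"
    and compl_upper: "\<forall>\<^sub>F k in sequentially. y k \<bullet> s k \<le> \<mu> k * c"
    and u: "u \<ge> 0"
    and primal:
      "\<forall>\<^sub>F k in sequentially. \<forall>i\<in>active a xstar. \<bar>a (x k) $ i + s k $ i\<bar> \<le> \<mu> k * u"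
    and d: "d \<ge> 0"
    and dual:
      "\<forall>\<^sub>F k in sequentially.
         norm (grad_lagrangian f a (x k) (y k)) \<le> d * \<mu> k * (l1_norm (y k) + 1)"
    and f_C2: "twice_continuously_differentiable f"
    and a_C2: "\<forall>i. twice_continuously_differentiable (\<lambda>z. a z $ i)"
    and sosc: "second_order_sufficient f a xstar ystar"
  shows "lagrange_multiplier f a xstar ystar \<and> maximally_complementary f a xstar ystar"
proof -
  have c: "0 \<le> c"
    using bc by simp
  interpret primal_dual_sequence f a x y s \<mu> xstar ystar b c u d
    by unfold_locales (fact assms c)+
  show ?thesis
    using multiplier multiplier_maximally_complementary[OF sosc] by blast
qed

end
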